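(* Let $h \geq 2$ and $\ell \geq 2$ be integers, let $s$ be a positive integer, and let $A$ be an infinite $B_{h-1,s}$-set of nonnegative integers. If $r_{A,h}(n) \geq \ell$ for all sufficiently large integers $n \in hA$, then there is a positive number $w_0$ such that \[ A(x) > \frac{(\ell - 1)\log x}{s \log h} - w_0 \] for all $x \geq h$.
   Context: For a set $A$ of integers, the counting function $A(x)$ is the number of positive integers $a \in A$ with $a \leq x$. For an integer $m \geq 1$, the $m$-fold sumset $mA$ is the set of all integers that can be written as a sum of $m$ not necessarily distinct elements of $A$. For every integer $n$, the representation function $r_{A,m}(n)$ is the number of $m$-tuples $(a_1,\ldots,a_m) \in A^m$ with $a_1 \leq a_2 \leq \cdots \leq a_m$ and $a_1 + \cdots + a_m = n$. For positive integers $m$ and $s$, a $B_{m,s}$-set is a set $A$ of nonnegative integers such that $r_{A,m}(n) \leq s$ for all $n \in mA$. *)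

theory Defs
  imports Complex_Main
begin

definition counting :: "int set \<Rightarrow> real \<Rightarrow> nat" where
  "counting A x = card {a \<in> A. 0 < a \<and> real_of_int a \<le> x}"

definition sumset :: "nat \<Rightarrow> int set \<Rightarrow> int set" where
  "sumset m A = {sum_list as | as. length as = m \<and> set as \<subseteq> A}"

text \<open>
  The value is the true number of tuples whenever \<open>A\<close> is bounded below, in particular
  for sets of nonnegative integers. For sets unbounded below there may be infinitely many
  tuples, and then \<open>card\<close> returns 0.
\<close>
definition rep_count :: "int set \<Rightarrow> nat \<Rightarrow> int \<Rightarrow> nat" where
  "rep_count A m n =
     card {as. length as = m \<and> set as \<subseteq> A \<and> sorted as \<and> sum_list as = n}"

definition B_set :: "nat \<Rightarrow> nat \<Rightarrow> int set \<Rightarrow> bool" where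
  "B_set m s A \<longleftrightarrow> (\<forall>a\<in>A. 0 \<le> a) \<and> (\<forall>n\<in>sumset m A. rep_count A m n \<le> s)"

end

theory Submission
  imports Defs
begin

text \<open>
  Let \<open>a \<in> A\<close> be large. Besides \<open>a + \<dots> + a\<close>, the number \<open>h a\<close> has at least \<open>l - 1\<close>
  representations, and the largest summand \<open>b\<close> of each satisfies \<open>a < b \<le> h a\<close>. Deleting
  \<open>b\<close> leaves a representation of \<open>h a - b\<close> with \<open>h - 1\<close> summands, so each \<open>b\<close> occurs at most
  \<open>s\<close> times and \<open>A\<close> has at least \<open>(l - 1) / s\<close> elements in \<open>(a, h a]\<close>. Taking for \<open>a\<close> the
  largest element of \<open>A\<close> up to \<open>x\<close> gives \<open>A(h x) \<ge> A(x) + (l - 1) / s\<close> for all large \<open>x\<close>,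
  and iterating this gives the logarithmic lower bound.
\<close>

definition reps :: "int set \<Rightarrow> nat \<Rightarrow> int \<Rightarrow> int list set" where
  "reps A m n = {as. length as = m \<and> set as \<subseteq> A \<and> sorted as \<and> sum_list as = n}"

lemma rep_count_eq_card_reps: "rep_count A m n = card (reps A m n)"
  by (simp add: rep_count_def reps_def)

lemma member_le_sum_list_nonneg:
  fixes xs :: "int list"
  assumes "\<forall>y\<in>set xs. 0 \<le> y" and "x \<in> set xs"
  shows "x \<le> sum_list xs"
  using assms
proof (induction xs)
  case (Cons y ys)
  then have "0 \<le> sum_list ys" by (intro sum_list_nonneg) auto
  with Cons show ?case by auto
qed simp

lemma finite_reps:
  assumes "\<forall>a\<in>A. 0 \<le> a"
  shows "finite (reps A m n)"
proof (rule finite_subset)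
  show "reps A m n \<subseteq> {xs. set xs \<subseteq> {0..n} \<and> length xs = m}"
  proof
    fix xs assume xs: "xs \<in> reps A m n"
    then have "\<forall>y\<in>set xs. 0 \<le> y" using assms by (auto simp: reps_def)
    with xs member_le_sum_list_nonneg show "xs \<in> {xs. set xs \<subseteq> {0..n} \<and> length xs = m}"
      by (fastforce simp: reps_def)
  qed
qed (simp add: finite_lists_length_eq)

text \<open>Outside the sumset there are no representations at all, so the bound \<open>s\<close>
  extends to every \<open>n\<close>. It can then be applied to the differences
  \<open>int m * a - b\<close> without checking that they lie in the sumset.\<close>

lemma card_reps_le:
  assumes "B_set m s A"
  shows "card (reps A m n) \<le> s"
proof (cases "n \<in> sumset m A")
  case True
  with assms show ?thesis by (simp add: B_set_def rep_count_eq_card_reps)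
next
  case False
  then have "reps A m n = {}" by (auto simp: reps_def sumset_def)
  then show ?thesis by simp
qed

lemma sum_list_le_length_mult:
  fixes xs :: "int list"
  assumes "\<forall>x\<in>set xs. x \<le> a"
  shows "sum_list xs \<le> int (length xs) * a"
  using assms by (induction xs) (auto simp: algebra_simps)

lemma eq_replicate_if_sum_list_max:
  fixes xs :: "int list"
  assumes "\<forall>x\<in>set xs. x \<le> a" and "sum_list xs = int (length xs) * a"
  shows "xs = replicate (length xs) a"
  using assms
proof (induction xs)
  case (Cons x xs)
  with sum_list_le_length_mult[of xs a] have "x = a" "sum_list xs = int (length xs) * a"
    by (auto simp: algebra_simps)
  with Cons show ?case by simp
qed simp

text \<open>Sortedness puts the largest summand \<open>b\<close> at the end, so dropping it leaves a
  sorted list. If \<open>b\<close> were at most \<open>a\<close>, the total \<open>int m * a\<close>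
  would force every entry to equal \<open>a\<close>, which is the excluded list.\<close>

lemma reps_diff_subset:
  assumes nonneg: "\<forall>a\<in>A. 0 \<le> a" and "m \<ge> 1"
  shows "reps A m (int m * a) - {replicate m a}
    \<subseteq> (\<Union>b\<in>{b\<in>A. a < b \<and> b \<le> int m * a}. (\<lambda>ys. ys @ [b]) ` reps A (m - 1) (int m * a - b))"
proof
  fix xs assume xs: "xs \<in> reps A m (int m * a) - {replicate m a}"
  with \<open>m \<ge> 1\<close> have "xs \<noteq> []" by (auto simp: reps_def)
  then obtain ys b where eq: "xs = ys @ [b]" by (metis rev_exhaust)
  have "b \<le> int m * a"
    using xs eq nonneg member_le_sum_list_nonneg[of xs b] by (auto simp: reps_def)
  moreover have "a < b"
  proof (rule ccontr)
    assume "\<not> a < b"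
    then have "\<forall>x\<in>set xs. x \<le> a"
      using xs eq by (auto simp: reps_def sorted_append)
    with xs eq_replicate_if_sum_list_max[of xs a] show False by (auto simp: reps_def)
  qed
  moreover have "b \<in> A" "ys \<in> reps A (m - 1) (int m * a - b)"
    using xs eq by (auto simp: reps_def sorted_append)
  ultimately show "xs \<in> (\<Union>b\<in>{b\<in>A. a < b \<and> b \<le> int m * a}.
      (\<lambda>ys. ys @ [b]) ` reps A (m - 1) (int m * a - b))"
    using eq by blast
qed

text \<open>The summand 1 pays for the constant list; the other lists are grouped by their last
  entry, and each group has at most \<open>s\<close> members.\<close>

lemma card_reps_mult_le:
  assumes B: "B_set (m - 1) s A" and "m \<ge> 1"
  shows "card (reps A m (int m * a)) \<le> s * card {b\<in>A. a < b \<and> b \<le> int m * a} + 1"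
proof -
  define I where "I = {b\<in>A. a < b \<and> b \<le> int m * a}"
  define F where "F b = (\<lambda>ys. ys @ [b]) ` reps A (m - 1) (int m * a - b)" for b
  have nonneg: "\<forall>a\<in>A. 0 \<le> a" using B by (simp add: B_set_def)
  have "finite I" unfolding I_def by (rule finite_subset[of _ "{a..int m * a}"]) auto
  have F: "finite (F b)" "card (F b) \<le> s" for b
    using finite_reps[OF nonneg] card_reps_le[OF B] card_image_le le_trans
    unfolding F_def by blast+
  have "reps A m (int m * a) \<subseteq> insert (replicate m a) (\<Union>b\<in>I. F b)"
    using reps_diff_subset[OF nonneg \<open>m \<ge> 1\<close>, of a] unfolding I_def F_def by blast
  then have "card (reps A m (int m * a)) \<le> card (insert (replicate m a) (\<Union>b\<in>I. F b))"
    using \<open>finite I\<close> F(1) by (intro card_mono) auto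
  also have "\<dots> \<le> card (\<Union>b\<in>I. F b) + 1"
    using \<open>finite I\<close> F(1) by (simp add: card_insert_if)
  also have "\<dots> \<le> (\<Sum>b\<in>I. card (F b)) + 1"
    using card_UN_le[OF \<open>finite I\<close>] by simp
  also have "\<dots> \<le> s * card I + 1"
    using sum_bounded_above[of I "\<lambda>b. card (F b)" s] F(2) by (simp add: mult.commute)
  finally show ?thesis by (simp add: I_def)
qed

lemma finite_counting_set: "finite {a \<in> A. 0 < a \<and> real_of_int a \<le> x}"
  by (rule finite_subset[of _ "{0..\<lfloor>x\<rfloor>}"]) (auto simp: le_floor_iff)

lemma counting_mult_ge:
  assumes B: "B_set (h - 1) s A" and "h \<ge> 1" "s \<ge> 1"
    and many: "\<forall>n\<in>sumset h A. n \<ge> n0 \<longrightarrow> rep_count A h n \<ge> l"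
    and c: "c \<in> A" "c > 0" "c \<ge> n0"
    and x: "x \<ge> real_of_int c"
  shows "real (counting A (real h * x)) \<ge> real (counting A x) + (real l - 1) / real s"
proof -
  define S where "S y = {a \<in> A. 0 < a \<and> real_of_int a \<le> y}" for y
  have fin: "finite (S y)" for y unfolding S_def by (rule finite_counting_set)
  have "c \<in> S x" using c x by (simp add: S_def)
  \<comment> \<open>The role of \<open>c\<close> is to make \<open>S x\<close> nonempty and to
    ensure that its maximum is at least \<open>n0\<close>.\<close>
  define a where "a = Max (S x)"
  have a: "a \<in> S x" "c \<le> a" and a_max: "\<And>b. b \<in> S x \<Longrightarrow> b \<le> a"
    using \<open>c \<in> S x\<close> fin[of x] unfolding a_def by (auto intro: Max_in)
  define I where "I = {b\<in>A. a < b \<and> b \<le> int h * a}"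
  have "finite I" unfolding I_def by (rule finite_subset[of _ "{a..int h * a}"]) auto
  have "int h * a \<ge> a" using a \<open>h \<ge> 1\<close> by (simp add: S_def)
  then have "int h * a \<ge> n0" using a c by linarith
  \<comment> \<open>The constant list that the count discards is also what places
    \<open>int h * a\<close> in the sumset, so that \<open>many\<close> applies.\<close>
  moreover have "int h * a \<in> sumset h A"
    unfolding sumset_def using a
    by (intro CollectI exI[of _ "replicate h a"]) (auto simp: S_def sum_list_replicate)
  ultimately have "l \<le> card (reps A h (int h * a))"
    using many a c by (simp add: rep_count_eq_card_reps)
  also have "\<dots> \<le> s * card I + 1"
    unfolding I_def using B \<open>h \<ge> 1\<close> by (rule card_reps_mult_le)
  finally have "real l - 1 \<le> real s * real (card I)"
    by (metis diff_le_eq of_nat_1 of_nat_add of_nat_le_iff of_nat_mult)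
  then have "(real l - 1) / real s \<le> real (card I)"
    using \<open>s \<ge> 1\<close> by (simp add: divide_le_eq mult.commute)
  moreover have "card (S x) + card I \<le> card (S (real h * x))"
  proof -
    \<comment> \<open>By maximality of \<open>a\<close>, no element of \<open>A\<close> lies in (a,
      x], so everything in \<open>I\<close> exceeds \<open>x\<close> and is new.\<close>
    have "S x \<inter> I = {}" using a_max by (fastforce simp: I_def)
    then have "card (S x) + card I = card (S x \<union> I)"
      using fin \<open>finite I\<close> by (simp add: card_Un_disjoint)
    also have "\<dots> \<le> card (S (real h * x))"
    proof (rule card_mono[OF fin])
      have "real h * real_of_int a \<le> real h * x" using a by (auto simp: S_def mult_left_mono)
      moreover have "real_of_int b \<le> real h * real_of_int a" "b > 0" "b \<in> A" if "b \<in> I" for b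
      proof -
        have "b \<le> int h * a" using that by (simp add: I_def)
        then have "real_of_int b \<le> real_of_int (int h * a)" by (rule of_int_le_iff[THEN iffD2])
        then show "real_of_int b \<le> real h * real_of_int a" by simp
        show "b > 0" "b \<in> A" using that a by (auto simp: I_def S_def)
      qed
      moreover have "x \<le> real h * x"
        using x c \<open>h \<ge> 1\<close> mult_right_mono[of 1 "real h" x] by simp
      ultimately show "S x \<union> I \<subseteq> S (real h * x)"
        unfolding S_def by (auto intro: order_trans)
    qed
    finally show ?thesis .
  qed
  ultimately show ?thesis unfolding counting_def S_def by linarith
qed

lemma counting_mono: "x \<le> y \<Longrightarrow> counting A x \<le> counting A y"
  unfolding counting_def by (rule card_mono[OF finite_counting_set]) auto

lemma infinite_nonneg_int_unbounded:
  fixes A :: "int set"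
  assumes "infinite A" "\<forall>a\<in>A. 0 \<le> a"
  obtains c where "c \<in> A" "c > k"
  using assms finite_subset[of A "{0..k}"] by (metis atLeastAtMost_iff finite_atLeastAtMost_int
      linorder_not_less subsetI)

text \<open>Starting at \<open>c\<close>, every multiplication by \<open>q\<close> gains
  \<open>d\<close>, and about log(x/c) / log q of them fit below \<open>x\<close>. The
  \<open>+ 1\<close> in the error term absorbs the rounding to a whole number of steps.\<close>

lemma ge_ln_if_mult_step:
  fixes f :: "real \<Rightarrow> nat" and q d c :: real
  assumes "mono f" "q > 1" "d \<ge> 0" "c > 0"
    and step: "\<And>x. x \<ge> c \<Longrightarrow> real (f (q * x)) \<ge> real (f x) + d"
    and "x > 0"
  shows "real (f x) \<ge> d * (ln x / ln q) - d * (ln c / ln q + 1)"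
proof (cases "x \<ge> c")
  case True
  have iter: "real (f (q ^ k * c)) \<ge> real k * d" for k
  proof (induction k)
    case (Suc k)
    have "c \<le> q ^ k * c" using \<open>q > 1\<close> \<open>c > 0\<close> by simp
    from step[OF this] Suc show ?case by (simp add: algebra_simps)
  qed simp
  define t where "t = ln (x / c) / ln q"
  \<comment> \<open>The largest number of steps for which \<open>q ^ k * c\<close> does not exceed
    \<open>x\<close>.\<close>
  define k where "k = nat \<lfloor>t\<rfloor>"
  have lnq: "ln q > 0" using \<open>q > 1\<close> by simp
  have "t \<ge> 0" using True \<open>c > 0\<close> lnq by (simp add: t_def)
  then have k: "real k \<le> t" "t \<le> real k + 1" by (auto simp: k_def)
  have "real k * ln q \<le> ln (x / c)"
    using k(1) lnq by (simp add: t_def pos_le_divide_eq)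
  then have "ln (q ^ k) \<le> ln (x / c)" using \<open>q > 1\<close> by (simp add: ln_realpow)
  then have "q ^ k \<le> x / c" using \<open>q > 1\<close> \<open>c > 0\<close> \<open>x > 0\<close> by (subst (asm) ln_le_cancel_iff) auto
  then have "q ^ k * c \<le> x" using \<open>c > 0\<close> by (simp add: pos_le_divide_eq)
  then have "real (f (q ^ k * c)) \<le> real (f x)" using \<open>mono f\<close> by (simp add: monoD)
  moreover have "d * (t - 1) \<le> d * real k"
    using k(2) \<open>d \<ge> 0\<close> by (intro mult_left_mono) auto
  moreover have "t = ln x / ln q - ln c / ln q"
    using \<open>c > 0\<close> \<open>x > 0\<close> by (simp add: t_def ln_div diff_divide_distrib)
  ultimately show ?thesis using iter[of k] by (simp add: algebra_simps)
next
  case False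
  \<comment> \<open>Below \<open>c\<close> the claimed lower bound is at most 0, and
    \<open>f\<close> takes natural values.\<close>
  have "ln x / ln q \<le> ln c / ln q"
    using False \<open>q > 1\<close> \<open>x > 0\<close> by (intro divide_right_mono) auto
  then have "d * (ln x / ln q) \<le> d * (ln c / ln q + 1)"
    using \<open>d \<ge> 0\<close> by (intro mult_left_mono) auto
  then show ?thesis by simp
qed

theorem theorem3:
  fixes h l s :: nat and A :: "int set"
  assumes "h \<ge> 2" and "l \<ge> 2" and "s \<ge> 1"
    and "infinite A"
    and "B_set (h - 1) s A"
    and "\<exists>n0::int. \<forall>n\<in>sumset h A. n \<ge> n0 \<longrightarrow> rep_count A h n \<ge> l"
  shows "\<exists>w0::real. w0 > 0 \<and>
    (\<forall>x::real. x \<ge> real h \<longrightarrow>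
       real (counting A x) > (real l - 1) * ln x / (real s * ln (real h)) - w0)"
proof -
  obtain n0 where n0: "\<forall>n\<in>sumset h A. n \<ge> n0 \<longrightarrow> rep_count A h n \<ge> l"
    using assms(6) by blast
  have "\<forall>a\<in>A. 0 \<le> a" using assms(5) by (simp add: B_set_def)
  then obtain c where c: "c \<in> A" "c > max 0 n0"
    using infinite_nonneg_int_unbounded[OF assms(4)] by blast
  define d where "d = (real l - 1) / real s"
  define w where "w = d * (ln (real_of_int c) / ln (real h) + 1)"
  have "d \<ge> 0" using assms(2) by (simp add: d_def)
  have "ln (real_of_int c) \<ge> 0" "ln (real h) \<ge> 0" using c assms(1) by auto
  with \<open>d \<ge> 0\<close> have "w \<ge> 0" by (simp add: w_def)
  have bound: "real (counting A x) \<ge> d * (ln x / ln (real h)) - w" if "x > 0" for x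
    unfolding w_def
  proof (rule ge_ln_if_mult_step)
    show "mono (counting A)" by (simp add: monoI counting_mono)
    show "real (counting A (real h * y)) \<ge> real (counting A y) + d" if "y \<ge> real_of_int c" for y
      unfolding d_def using counting_mult_ge[OF assms(5) _ assms(3) n0 c(1)] that c(2) assms(1)
      by simp
  qed (use assms(1) c \<open>d \<ge> 0\<close> that in auto)
  \<comment> \<open>Since \<open>w\<close> may be 0 for all that is shown and \<open>bound\<close>
    is not strict, adding 1 gives both a positive constant and a strict inequality.\<close>
  have "real (counting A x) > (real l - 1) * ln x / (real s * ln (real h)) - (w + 1)"
    if "x \<ge> real h" for x
    using bound[of x] that assms(1) by (simp add: d_def)
  with \<open>w \<ge> 0\<close> show ?thesis by (intro exI[of _ "w + 1"]) auto
qed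

end
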